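(* Let $L$ be a real number and let $\lambda,\mu\in\Lambda$ satisfy $$|\lambda(a,b)-\mu(a,b)|\le L\max\{a,b\}\qquad(0\le a,b\le2).$$ Then for every real normed space $X$ with $\dim X\ge 2$ and every $p\in[1,\infty]$, $$|\mathfrak{C}_{\lambda,p}(X)-\mathfrak{C}_{\mu,p}(X)|\le 2L,$$ and, when $p<\infty$, the sharper bound $$|\mathfrak{C}_{\lambda,p}(X)-\mathfrak{C}_{\mu,p}(X)|\le 2^{1-1/p}L$$ holds.
   Context: $\Lambda$ is the class of all continuous functions $\lambda:[0,\infty)^2\to[0,\infty)$ that are homogeneous of degree one and satisfy $\lambda(1,1)=1$. $S_X$ is the unit sphere of $X$. For $(r,s)\in\mathbb{R}^2$, $\|(r,s)\|_p=(|r|^p+|s|^p)^{1/p}$ if $1\le p<\infty$ and $\|(r,s)\|_\infty=\max\{|r|,|s|\}$. For $\lambda\in\Lambda$, $$\mathfrak{C}_{\lambda,p}(X)=\sup\{\lambda(\|ru+sv\|,\|su-rv\|):u,v\in S_X,\ r,s\ge0,\ \|(r,s)\|_p=1\}.$$ *)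

theory Defs
  imports "HOL-Analysis.Analysis"
begin

text \<open>Functions on the closed quadrant are represented by total functions on
  \<^typ>\<open>real \<times> real\<close>; values off the quadrant are unconstrained and never used.\<close>

definition Lambda_class :: "(real \<times> real \<Rightarrow> real) set" where
  "Lambda_class = {l. l \<in> {0..} \<times> {0..} \<rightarrow> {0..} \<and>
     continuous_on ({0..} \<times> {0..}) l \<and>
     (\<forall>t\<ge>0. \<forall>a\<ge>0. \<forall>b\<ge>0. l (t * a, t * b) = t * l (a, b)) \<and>
     l (1, 1) = 1}"

definition lp_norm :: "ereal \<Rightarrow> real \<Rightarrow> real \<Rightarrow> real" where
  "lp_norm p r s =
     (if p = \<infinity> then max \<bar>r\<bar> \<bar>s\<bar>
      else (\<bar>r\<bar> powr real_of_ereal p + \<bar>s\<bar> powr real_of_ereal p) powr (1 / real_of_ereal p))"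

text \<open>The supremum is taken in \<^typ>\<open>real\<close>. For \<open>l\<close> in \<^const>\<open>Lambda_class\<close>, \<open>p \<ge> 1\<close> and a
  nontrivial space, the set is nonempty and bounded: both arguments of \<open>l\<close> lie in
  \<open>[0, 2]\<close>, and \<open>l\<close> is continuous there.\<close>

definition C_const ::
  "'a::real_normed_vector itself \<Rightarrow> (real \<times> real \<Rightarrow> real) \<Rightarrow> ereal \<Rightarrow> real" where
  "C_const X l p =
     Sup {l (norm (r *\<^sub>R u + s *\<^sub>R v), norm (s *\<^sub>R u - r *\<^sub>R v)) | (u::'a) (v::'a) r s.
            u \<in> sphere 0 1 \<and> v \<in> sphere 0 1 \<and> r \<ge> 0 \<and> s \<ge> 0 \<and> lp_norm p r s = 1}"

text \<open>\<^const>\<open>dim\<close> is not used here because it only measures finite-dimensional spaces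
  correctly, whereas spaces of infinite dimension are to be included.\<close>

definition dim_at_least_2 :: "'a::real_normed_vector itself \<Rightarrow> bool" where
  "dim_at_least_2 X \<longleftrightarrow> (\<exists>B::'a set. independent B \<and> card B = 2)"

end

theory Submission
  imports Defs
begin

text \<open>By the power mean inequality, \<open>\<parallel>(r, s)\<parallel>\<^sub>p = 1\<close> forces \<open>r + s \<le> 2\<^bsup>1 - 1/p\<^esup> \<le> 2\<close>, so by the
  triangle inequality both norms lie in \<open>[0, 2\<^bsup>1 - 1/p\<^esup>]\<close>, where the two functions differ by
  at most \<open>2\<^bsup>1 - 1/p\<^esup> L\<close>; hence so do the suprema.\<close>

text \<open>Midpoint convexity of \<open>x powr q\<close>, multiplied by \<open>2 powr q\<close>.
  Convexity is applied to positive arguments; if \<open>r\<close> or \<open>s\<close> vanishes, the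
  claim reduces to \<open>2 powr (q - 1)\<close> being at least 1.\<close>

lemma powr_add_le_convex:
  fixes r s q :: real
  assumes "0 \<le> r" "0 \<le> s" "1 \<le> q"
  shows "(r + s) powr q \<le> 2 powr (q - 1) * (r powr q + s powr q)"
proof (cases "r = 0 \<or> s = 0")
  case True
  have "1 * x \<le> 2 powr (q - 1) * x" if "0 \<le> x" for x :: real
    using assms(3) that by (intro mult_right_mono ge_one_powr_ge_zero) auto
  then show ?thesis
    using True by auto
next
  case False
  then have "((1 - 1/2) *\<^sub>R r + (1/2) *\<^sub>R s) powr q \<le> (1 - 1/2) * r powr q + (1/2) * s powr q"
    using assms by (intro convex_onD[OF powr_convex]) auto
  then have "((r + s) / 2) powr q \<le> (r powr q + s powr q) / 2"
    by (simp add: add_divide_distrib)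
  then show ?thesis
    using assms by (simp add: powr_divide powr_diff field_simps)
qed

lemma lp_norm_one_sum_le:
  assumes "0 \<le> r" "0 \<le> s" "1 \<le> p" "p < \<infinity>" "lp_norm p r s = 1"
  shows "r + s \<le> 2 powr (1 - 1 / real_of_ereal p)"
proof -
  obtain q where p: "p = ereal q" and q: "1 \<le> q"
    using assms by (cases p) auto
  have "(r powr q + s powr q) powr (1/q) = 1"
    using assms by (simp add: lp_norm_def p)
  then have "((r powr q + s powr q) powr (1/q)) powr q = 1"
    by simp
  then have "r powr q + s powr q = 1"
    using q by (simp add: powr_powr)
  \<comment> \<open>Taking \<open>q\<close>-th roots turns the exponent \<open>q - 1\<close> into
    \<open>1 - 1/q\<close>.\<close>
  then have "((r + s) powr q) powr (1/q) \<le> (2 powr (q - 1)) powr (1/q)"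
    using powr_add_le_convex[of r s q] assms q by (intro powr_mono2) auto
  then show ?thesis
    using assms q by (simp add: p powr_powr diff_divide_distrib)
qed

lemma two_powr_one_minus_inverse_le:
  assumes "1 \<le> p" "p < \<infinity>"
  shows "2 powr (1 - 1 / real_of_ereal p) \<le> (2::real)"
proof -
  obtain q where "p = ereal q" "1 \<le> q"
    using assms by (cases p) auto
  then show ?thesis
    using powr_mono[of "1 - 1/q" 1 "2::real"] by simp
qed

lemma lp_norm_one_sum_le_two:
  assumes "0 \<le> r" "0 \<le> s" "1 \<le> p" "lp_norm p r s = 1"
  shows "r + s \<le> 2"
proof (cases "p = \<infinity>")
  case True
  then show ?thesis
    using assms by (simp add: lp_norm_def max_def split: if_splits)
next
  case False
  then have "p < \<infinity>" by simp
  then show ?thesis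
    using lp_norm_one_sum_le[of r s p] two_powr_one_minus_inverse_le[of p] assms by linarith
qed

text \<open>Provides a point of the unit sphere of every \<open>lp_norm p\<close>; it holds for all
  \<open>p\<close> because \<open>0 powr x = 0\<close> for every \<open>x\<close>.\<close>

lemma lp_norm_one_zero: "lp_norm p 1 0 = 1"
  by (simp add: lp_norm_def)

lemma abs_cSUP_diff_le:
  fixes f g :: "'b \<Rightarrow> real"
  assumes "I \<noteq> {}" "bdd_above (f ` I)" "bdd_above (g ` I)"
    and "\<And>i. i \<in> I \<Longrightarrow> \<bar>f i - g i\<bar> \<le> c"
  shows "\<bar>(SUP i\<in>I. f i) - (SUP i\<in>I. g i)\<bar> \<le> c"
proof -
  have le: "f i \<le> (SUP i\<in>I. g i) + c" "g i \<le> (SUP i\<in>I. f i) + c" if "i \<in> I" for i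
    using assms(4)[OF that] cSUP_upper[OF that assms(2)] cSUP_upper[OF that assms(3)]
    by linarith+
  have "(SUP i\<in>I. f i) \<le> (SUP i\<in>I. g i) + c" "(SUP i\<in>I. g i) \<le> (SUP i\<in>I. f i) + c"
    using assms(1) le by (auto intro: cSUP_least)
  then show ?thesis by linarith
qed

text \<open>Independent of the function \<open>l\<close>, so that the two constants become suprema
  of different functions over one common index set.\<close>

definition admissible :: "'a::real_normed_vector itself \<Rightarrow> ereal \<Rightarrow> (real \<times> real) set" where
  "admissible X p = {(norm (r *\<^sub>R u + s *\<^sub>R v), norm (s *\<^sub>R u - r *\<^sub>R v)) | (u::'a) v r s.
     u \<in> sphere 0 1 \<and> v \<in> sphere 0 1 \<and> r \<ge> 0 \<and> s \<ge> 0 \<and> lp_norm p r s = 1}"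

lemma C_const_eq_SUP: "C_const X l p = (SUP x\<in>admissible X p. l x)"
  unfolding C_const_def admissible_def by (rule arg_cong[where f = Sup]) blast

text \<open>By the triangle inequality both norms are at most \<open>r + s\<close>. The bound
  \<open>K\<close> is left open to serve both estimates of the theorem.\<close>

lemma admissible_subset_square:
  fixes X :: "'a::real_normed_vector itself"
  assumes "\<And>r s. 0 \<le> r \<Longrightarrow> 0 \<le> s \<Longrightarrow> lp_norm p r s = 1 \<Longrightarrow> r + s \<le> K"
  shows "admissible X p \<subseteq> {0..K} \<times> {0..K}"
proof -
  have "norm (r *\<^sub>R u + s *\<^sub>R v) \<le> K \<and> norm (s *\<^sub>R u - r *\<^sub>R v) \<le> K"
    if "norm u = 1" "norm v = 1" "0 \<le> r" "0 \<le> s" "lp_norm p r s = 1" for u v :: 'a and r s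
    using that assms[of r s] norm_triangle_ineq[of "r *\<^sub>R u" "s *\<^sub>R v"]
      norm_triangle_ineq4[of "s *\<^sub>R u" "r *\<^sub>R v"] by simp
  then show ?thesis
    unfolding admissible_def by auto
qed

text \<open>An independent set omits 0, so normalising one of its elements gives a unit vector; it
  serves as \<open>u\<close> and \<open>v\<close>, with \<open>r = 1\<close> and
  \<open>s = 0\<close>.\<close>

lemma admissible_nonempty:
  assumes "dim_at_least_2 TYPE('a::real_normed_vector)"
  shows "admissible TYPE('a) p \<noteq> {}"
proof -
  obtain B :: "'a set" where "independent B" "card B = 2"
    using assms unfolding dim_at_least_2_def by blast
  then obtain x :: 'a where "x \<noteq> 0"
    by (metis card_2_iff' dependent_zero)
  then have "norm (sgn x) = 1" by (simp add: norm_sgn)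
  then show ?thesis
    unfolding admissible_def using lp_norm_one_zero[of p] by fastforce
qed

text \<open>A continuous function has compact image on the square. This makes the real-valued
  suprema genuine least upper bounds.\<close>

lemma Lambda_class_bdd_above:
  assumes "l \<in> Lambda_class" "A \<subseteq> {0..K} \<times> {0..K}"
  shows "bdd_above (l ` A)"
proof -
  have "continuous_on ({0..K} \<times> {0..K}) l"
    using assms(1) unfolding Lambda_class_def by (auto elim: continuous_on_subset)
  then have "compact (l ` ({0..K} \<times> {0..K}))"
    by (intro compact_continuous_image compact_Times) auto
  then show ?thesis
    using assms(2) by (meson bdd_above_mono bounded_imp_bdd_above compact_imp_bounded image_mono)
qed

theorem proposition9:
  fixes L :: real and l m :: "real \<times> real \<Rightarrow> real" and p :: ereal
  assumes "l \<in> Lambda_class" and "m \<in> Lambda_class"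
    and "\<And>a b. 0 \<le> a \<Longrightarrow> a \<le> 2 \<Longrightarrow> 0 \<le> b \<Longrightarrow> b \<le> 2 \<Longrightarrow> \<bar>l (a, b) - m (a, b)\<bar> \<le> L * max a b"
    and "dim_at_least_2 TYPE('a::real_normed_vector)"
    and "1 \<le> p"
  shows "\<bar>C_const TYPE('a) l p - C_const TYPE('a) m p\<bar> \<le> 2 * L \<and>
    (p < \<infinity> \<longrightarrow>
      \<bar>C_const TYPE('a) l p - C_const TYPE('a) m p\<bar> \<le> 2 powr (1 - 1 / real_of_ereal p) * L)"
proof -
  \<comment> \<open>At (1, 1) the hypothesis bounds an absolute value by \<open>L\<close>.\<close>
  have "0 \<le> L"
    using assms(3)[of 1 1] by simp
  \<comment> \<open>The condition \<open>K \<le> 2\<close> keeps the admissible pairs inside the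
    square where \<open>l\<close> and \<open>m\<close> are compared.\<close>
  have bound: "\<bar>C_const TYPE('a) l p - C_const TYPE('a) m p\<bar> \<le> K * L"
    if "K \<le> 2" and K: "\<And>r s. 0 \<le> r \<Longrightarrow> 0 \<le> s \<Longrightarrow> lp_norm p r s = 1 \<Longrightarrow> r + s \<le> K" for K
    unfolding C_const_eq_SUP
  proof (rule abs_cSUP_diff_le)
    have sub: "admissible TYPE('a) p \<subseteq> {0..K} \<times> {0..K}"
      using K by (rule admissible_subset_square)
    show "admissible TYPE('a) p \<noteq> {}"
      using assms(4) by (rule admissible_nonempty)
    show "bdd_above (l ` admissible TYPE('a) p)" "bdd_above (m ` admissible TYPE('a) p)"
      using assms(1,2) sub by (auto intro: Lambda_class_bdd_above)
    show "\<bar>l x - m x\<bar> \<le> K * L" if x_in: "x \<in> admissible TYPE('a) p" for x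
    proof -
      obtain a b where x: "x = (a, b)" "0 \<le> a" "a \<le> K" "0 \<le> b" "b \<le> K"
        using subsetD[OF sub x_in] by auto
      then have "\<bar>l x - m x\<bar> \<le> L * max a b"
        using assms(3)[of a b] \<open>K \<le> 2\<close> by simp
      also have "\<dots> \<le> L * K"
        using x \<open>0 \<le> L\<close> by (intro mult_left_mono) auto
      finally show ?thesis by (simp add: mult.commute)
    qed
  qed
  show ?thesis
    \<comment> \<open>\<open>K = 2\<close> works for every \<open>p\<close>, including
      \<open>\<infinity>\<close>; the smaller value is used for finite \<open>p\<close>.\<close>
    using bound[of 2] bound[of "2 powr (1 - 1 / real_of_ereal p)"] assms(5)
      lp_norm_one_sum_le lp_norm_one_sum_le_two two_powr_one_minus_inverse_le by auto
qed

end
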